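(* Let $f$ be a polynomial of degree $n$ with rational coefficients. Assume that $f$ is irreducible over $\mathbb{Q}$ and $1$-solvable. Then $f$ has a root of the form $A(r)$, where $A$ is a polynomial with rational coefficients and $r\in\mathbb{R}$ is a number satisfying $r^n\in\mathbb{Q}$.
   Context: A polynomial with rational coefficients is called $1$-solvable if it has a root $x\in\mathbb{Q}[r]$ for some $r\in\mathbb{R}$ such that $r^m\in\mathbb{Q}$ for some positive integer $m$. Here $\mathbb{Q}[r]=\{A(r): A \text{ a polynomial with rational coefficients}\}$. *)

theory Defs
  imports Complex_Main "HOL-Computational_Algebra.Computational_Algebra"
begin

abbreviation eval_rat_poly :: "rat poly \<Rightarrow> real \<Rightarrow> real" where
  "eval_rat_poly p x \<equiv> poly (map_poly of_rat p) x"

definition rat_adjoin :: "real \<Rightarrow> real set" where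
  "rat_adjoin r = {eval_rat_poly A r | A. True}"

definition one_solvable :: "rat poly \<Rightarrow> bool" where
  "one_solvable f \<longleftrightarrow>
     (\<exists>r m. m > 0 \<and> r ^ m \<in> \<rat> \<and> (\<exists>x\<in>rat_adjoin r. eval_rat_poly f x = 0))"

end

theory Submission
  imports Defs "HOL-Computational_Algebra.Field_as_Ring"
begin

text \<open>
  Let \<open>x\<close> be a root of \<open>f\<close> in \<open>\<rat>[r]\<close>, where \<open>r\<close> is a real number with \<open>r ^ m \<in> \<rat>\<close>, and put
  \<open>K = \<rat>[x]\<close>, a subfield of the reals.

  The argument rests on a substitute for the norm.  If a real number \<open>s\<close> has degree \<open>k\<close>
  over a field \<open>L\<close> of real numbers and some positive power of \<open>s\<close> lies in \<open>L\<close>, then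
  \<open>s ^ k \<in> L\<close>: the minimal polynomial \<open>g\<close> of \<open>s\<close> divides \<open>X ^ m - s ^ m\<close>, so all its \<open>k\<close> complex
  roots have absolute value \<open>\<bar>s\<bar>\<close>, and \<open>g(0) \<in> L\<close>, being real, can only be \<open>s ^ k\<close> or \<open>- (s ^ k)\<close>
  (lemma \<open>power_degree_mem\<close>).

  This is used twice.  Over \<open>K\<close> it gives an exponent \<open>k\<close>, the degree of \<open>r\<close> over \<open>K\<close>, such
  that \<open>s = r ^ k\<close> lies in \<open>K\<close>.  Conversely \<open>x \<in> \<rat>[s]\<close>: write \<open>x = A(r)\<close> and reduce \<open>A\<close> modulo
  \<open>X ^ k - s\<close> to a polynomial \<open>h\<close> over \<open>\<rat>[s]\<close> of degree less than \<open>k\<close>.  Then \<open>h - x\<close> is a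
  polynomial over \<open>K\<close> of degree less than \<open>k\<close> that vanishes at \<open>r\<close>, so it is zero, and \<open>x\<close> is
  the constant coefficient of \<open>h\<close> (lemma \<open>mem_rat_adjoin_power\<close>).  Hence \<open>\<rat>[s] = \<rat>[x]\<close>, and \<open>s\<close> has
  the same degree over \<open>\<rat>\<close> as \<open>x\<close>, namely \<open>n\<close>.  As a power of \<open>r ^ m\<close>, the number \<open>s ^ m\<close> is
  rational, and the same principle over \<open>\<rat>\<close> shows that \<open>s ^ n\<close> is rational.
\<close>

section \<open>Division with remainder over a subring\<close>

definition coeffs_in :: "'a::zero set \<Rightarrow> 'a poly \<Rightarrow> bool" where
  "coeffs_in R p \<longleftrightarrow> (\<forall>i. coeff p i \<in> R)"

locale subring_of =
  fixes R :: "'a::comm_ring_1 set"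
  assumes zero_mem: "0 \<in> R"
    and one_mem: "1 \<in> R"
    and add_mem: "a \<in> R \<Longrightarrow> b \<in> R \<Longrightarrow> a + b \<in> R"
    and uminus_mem: "a \<in> R \<Longrightarrow> - a \<in> R"
    and mult_mem: "a \<in> R \<Longrightarrow> b \<in> R \<Longrightarrow> a * b \<in> R"
begin

lemma diff_mem: "a \<in> R \<Longrightarrow> b \<in> R \<Longrightarrow> a - b \<in> R"
  using add_mem[of a "- b"] uminus_mem[of b] by simp

lemma power_mem: "a \<in> R \<Longrightarrow> a ^ i \<in> R"
  by (induction i) (auto intro: one_mem mult_mem)

lemma sum_mem: "(\<And>i. i \<in> I \<Longrightarrow> u i \<in> R) \<Longrightarrow> sum u I \<in> R"
  by (induction I rule: infinite_finite_induct) (auto intro: zero_mem add_mem)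

lemma coeffs_in_diff: "coeffs_in R p \<Longrightarrow> coeffs_in R q \<Longrightarrow> coeffs_in R (p - q)"
  by (auto simp: coeffs_in_def intro: diff_mem)

lemma coeffs_in_monom: "c \<in> R \<Longrightarrow> coeffs_in R (monom c i)"
  by (auto simp: coeffs_in_def intro: zero_mem)

lemma coeffs_in_const: "c \<in> R \<Longrightarrow> coeffs_in R [:c:]"
  using coeffs_in_monom[of c 0] by (simp add: monom_0)

lemma coeffs_in_mult: "coeffs_in R p \<Longrightarrow> coeffs_in R q \<Longrightarrow> coeffs_in R (p * q)"
  by (auto simp: coeffs_in_def coeff_mult intro!: sum_mem mult_mem)

text \<open>
  Long division by a monic polynomial stays inside the coefficient ring.  The remainder is
  described by its vanishing coefficients: a bound on its degree could not say that the
  remainder of division by a constant is zero.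
\<close>

lemma monic_division:
  assumes g: "coeffs_in R g" "lead_coeff g = 1" and p: "coeffs_in R p"
  obtains q h where "p = g * q + h" "coeffs_in R h" "\<And>i. i \<ge> degree g \<Longrightarrow> coeff h i = 0"
proof -
  have "\<exists>q h. p = g * q + h \<and> coeffs_in R h \<and> (\<forall>i\<ge>degree g. coeff h i = 0)"
    if "coeffs_in R p" "\<forall>i\<ge>d. coeff p i = 0" for p d
    using that
  proof (induction d arbitrary: p)
    case 0
    then show ?case by (intro exI[of _ 0] exI[of _ p]) auto
  next
    case (Suc d)
    show ?case
    proof (cases "degree g \<le> d")
      case False
      then show ?thesis
        using Suc.prems by (intro exI[of _ 0] exI[of _ p]) auto
    next
      case True
      \<comment> \<open>\<open>g * ?t\<close> has the same coefficient as \<open>p\<close> at \<open>d\<close>, the only place where \<open>p\<close> may exceed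
        the bound of the induction hypothesis.\<close>
      let ?t = "monom (coeff p d) (d - degree g)"
      let ?p' = "p - g * ?t"
      have "coeffs_in R ?p'"
        using Suc.prems(1) g(1)
        by (intro coeffs_in_diff coeffs_in_mult coeffs_in_monom) (auto simp: coeffs_in_def)
      moreover have "coeff ?p' i = 0" if i: "i \<ge> d" for i
      proof (cases "i = d")
        case True
        then show ?thesis
          using \<open>degree g \<le> d\<close> g(2) by (simp add: mult.commute[of g] coeff_monom_mult)
      next
        case False
        then have "coeff p i = 0" "coeff g (i - (d - degree g)) = 0"
          using i \<open>degree g \<le> d\<close> Suc.prems(2) by (auto intro!: coeff_eq_0)
        then show ?thesis
          by (simp add: mult.commute[of g] coeff_monom_mult)
      qed
      ultimately obtain q h where "?p' = g * q + h" "coeffs_in R h"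
        "\<forall>i\<ge>degree g. coeff h i = 0"
        using Suc.IH[of ?p'] by blast
      then show ?thesis
        by (intro exI[of _ "q + ?t"] exI[of _ h]) (auto simp: algebra_simps)
    qed
  qed
  from this[OF p, of "Suc (degree p)"] that show thesis
    by (auto simp: coeff_eq_0)
qed

end

section \<open>Minimal polynomials of real radicals\<close>

lemma map_poly_mult_hom:
  fixes \<phi> :: "'a::comm_ring_1 \<Rightarrow> 'b::comm_ring_1"
  assumes "\<phi> 0 = 0" "\<And>a b. \<phi> (a + b) = \<phi> a + \<phi> b" "\<And>a b. \<phi> (a * b) = \<phi> a * \<phi> b"
  shows "map_poly \<phi> (p * q) = map_poly \<phi> p * map_poly \<phi> q"
proof -
  have "\<phi> (sum u I) = (\<Sum>i\<in>I. \<phi> (u i))" for u and I :: "nat set"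
    by (induction I rule: infinite_finite_induct) (auto simp: assms)
  then show ?thesis
    by (intro poly_eqI) (simp add: coeff_map_poly coeff_mult assms)
qed

text \<open>The constant coefficient of a monic polynomial is, up to sign, the product of its roots.\<close>

lemma norm_const_coeff_equal_norm_roots:
  fixes p :: "complex poly"
  assumes "lead_coeff p = 1" "\<And>z. poly p z = 0 \<Longrightarrow> norm z = c"
  shows "norm (poly p 0) = c ^ degree p"
proof -
  obtain root where "smult (lead_coeff p) (\<Prod>i<degree p. [:- root i, 1:]) = p"
    by (rule complex_poly_decompose')
  then have root: "p = (\<Prod>i<degree p. [:- root i, 1:])"
    using assms(1) by simp
  have eval: "poly p z = (\<Prod>i<degree p. z - root i)" for z
    by (subst root) (simp add: poly_prod)
  have "norm (root i) = c" if "i < degree p" for i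
    using that by (intro assms(2)) (auto simp: eval)
  then show ?thesis
    by (simp add: eval norm_mult flip: prod_norm)
qed

locale real_subfield = subring_of K for K :: "real set" +
  assumes inverse_mem: "a \<in> K \<Longrightarrow> inverse a \<in> K"
begin

text \<open>
  Minimality is phrased through vanishing coefficients, so that it applies directly to
  the remainders of \<open>monic_division\<close>.
\<close>

definition minimal_poly :: "real \<Rightarrow> real poly \<Rightarrow> bool" where
  "minimal_poly s g \<longleftrightarrow> coeffs_in K g \<and> lead_coeff g = 1 \<and> poly g s = 0 \<and>
     (\<forall>h. coeffs_in K h \<longrightarrow> poly h s = 0 \<longrightarrow> (\<forall>i\<ge>degree g. coeff h i = 0) \<longrightarrow> h = 0)"

lemma minimal_poly_exists:
  assumes "coeffs_in K p" "p \<noteq> 0" "poly p s = 0"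
  obtains g where "minimal_poly s g"
proof -
  let ?P = "\<lambda>h. coeffs_in K h \<and> h \<noteq> 0 \<and> poly h s = 0"
  from assms have "?P p" by simp
  then obtain g where g: "?P g" and least: "\<And>h. ?P h \<Longrightarrow> degree g \<le> degree h"
    using ex_has_least_nat[of ?P p degree] by blast
  let ?g = "smult (inverse (lead_coeff g)) g"
  have deg: "degree ?g = degree g"
    using g by simp
  have "h = 0" if h: "coeffs_in K h" "poly h s = 0" "\<forall>i\<ge>degree g. coeff h i = 0" for h
  proof (rule ccontr)
    assume "h \<noteq> 0"
    then have "degree g \<le> degree h" using least h by blast
    then have "lead_coeff h = 0" using h(3) by blast
    with \<open>h \<noteq> 0\<close> show False by simp
  qed
  moreover have "coeffs_in K ?g"
    using g by (auto simp: coeffs_in_def intro!: mult_mem inverse_mem)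
  moreover have "lead_coeff ?g = 1" "poly ?g s = 0"
    using g by auto
  ultimately have "minimal_poly s ?g"
    unfolding minimal_poly_def deg by blast
  with that show thesis .
qed

lemma minimal_poly_degree_pos:
  assumes "minimal_poly s g"
  shows "degree g > 0"
proof (rule ccontr)
  assume "\<not> degree g > 0"
  then obtain c where "g = [:c:]" using degree_eq_zeroE by blast
  with assms show False by (auto simp: minimal_poly_def)
qed

text \<open>
  The conjugates of \<open>s\<close> are among the roots of \<open>X ^ m - s ^ m\<close>, so they all have the absolute
  value of \<open>s\<close>.  Their product is, up to sign, the constant coefficient of the minimal polynomial;
  a real number is determined up to sign by its absolute value.
\<close>

lemma power_degree_mem:
  assumes g: "minimal_poly s g" and m: "m > 0" "s ^ m \<in> K"
  shows "s ^ degree g \<in> K"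
proof -
  from g have g_in: "coeffs_in K g" and monic: "lead_coeff g = 1" and "poly g s = 0"
    by (auto simp: minimal_poly_def)
  let ?p = "monom 1 m - [:s ^ m:] :: real poly"
  have "coeffs_in K ?p"
    using m by (intro coeffs_in_diff coeffs_in_monom coeffs_in_const one_mem)
  then obtain q h where qh: "?p = g * q + h" "coeffs_in K h"
    "\<And>i. i \<ge> degree g \<Longrightarrow> coeff h i = 0"
    using monic_division[OF g_in monic] by blast
  have "poly ?p s = poly (g * q + h) s" by (simp only: qh(1))
  then have "poly h s = 0"
    using \<open>poly g s = 0\<close> by (simp add: poly_monom)
  with g qh have "h = 0"
    by (auto simp: minimal_poly_def)
  with qh have factor: "g * q = ?p" by simp
  let ?c = "map_poly complex_of_real"
  have "norm z = \<bar>s\<bar>" if "poly (?c g) z = 0" for z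
  proof -
    have "poly (?c ?p) z = 0"
      using that by (simp flip: factor add: map_poly_mult_hom)
    moreover have "?c ?p = monom 1 m - [:of_real (s ^ m):]"
      by (intro poly_eqI) (auto simp: coeff_map_poly coeff_pCons split: nat.splits)
    ultimately have "z ^ m = of_real (s ^ m)"
      by (simp add: poly_monom)
    then have "norm z ^ m = \<bar>s\<bar> ^ m"
      by (metis norm_of_real norm_power power_abs)
    with m(1) show ?thesis
      by (metis abs_ge_zero norm_ge_zero power_eq_iff_eq_base)
  qed
  moreover have deg: "degree (?c g) = degree g"
    by (simp add: degree_map_poly)
  moreover have "lead_coeff (?c g) = 1"
    using monic unfolding deg by (simp add: coeff_map_poly)
  ultimately have "norm (poly (?c g) 0) = \<bar>s\<bar> ^ degree g"
    using norm_const_coeff_equal_norm_roots[of "?c g"] by simp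
  then have "\<bar>coeff g 0\<bar> = \<bar>s ^ degree g\<bar>"
    by (simp add: poly_0_coeff_0 coeff_map_poly power_abs)
  then have "s ^ degree g = coeff g 0 \<or> s ^ degree g = - coeff g 0"
    by linarith
  then show ?thesis
    using g_in uminus_mem by (auto simp: coeffs_in_def)
qed

lemma minimal_poly_of_radical:
  assumes "m > 0" "s ^ m \<in> K"
  obtains g where "minimal_poly s g" "s ^ degree g \<in> K"
proof -
  have "coeffs_in K (monom 1 m - [:s ^ m:])"
    using assms by (intro coeffs_in_diff coeffs_in_monom coeffs_in_const one_mem)
  moreover have "monom 1 m - [:s ^ m:] \<noteq> (0 :: real poly)"
  proof
    assume "monom 1 m - [:s ^ m:] = (0 :: real poly)"
    then have "coeff (monom 1 m - [:s ^ m:]) m = (0 :: real)" by simp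
    then show False using \<open>m > 0\<close> by (simp add: coeff_pCons split: nat.splits)
  qed
  moreover have "poly (monom 1 m - [:s ^ m:]) s = 0"
    by (simp add: poly_monom)
  ultimately obtain g where "minimal_poly s g"
    by (rule minimal_poly_exists)
  with that power_degree_mem assms show thesis by blast
qed

end

section \<open>Rings generated by one real number\<close>

lemma eval_rat_poly_add: "eval_rat_poly (p + q) x = eval_rat_poly p x + eval_rat_poly q x"
proof -
  have "map_poly (of_rat :: rat \<Rightarrow> real) (p + q) = map_poly of_rat p + map_poly of_rat q"
    by (intro poly_eqI) (simp add: coeff_map_poly of_rat_add)
  then show ?thesis by simp
qed

lemma eval_rat_poly_minus: "eval_rat_poly (- p) x = - eval_rat_poly p x"
proof -
  have "map_poly (of_rat :: rat \<Rightarrow> real) (- p) = - map_poly of_rat p"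
    by (intro poly_eqI) (simp add: coeff_map_poly of_rat_minus)
  then show ?thesis by simp
qed

lemma eval_rat_poly_mult: "eval_rat_poly (p * q) x = eval_rat_poly p x * eval_rat_poly q x"
  by (simp add: map_poly_mult_hom of_rat_add of_rat_mult)

lemma eval_rat_poly_const: "eval_rat_poly [:c:] x = of_rat c"
  by (cases "c = 0") (simp_all add: map_poly_pCons)

lemma eval_rat_poly_monom: "eval_rat_poly (monom c i) x = of_rat c * x ^ i"
  by (simp add: map_poly_monom poly_monom)

lemma eval_rat_poly_sum: "eval_rat_poly (\<Sum>i\<in>I. u i) x = (\<Sum>i\<in>I. eval_rat_poly (u i) x)"
  by (induction I rule: infinite_finite_induct) (simp_all add: eval_rat_poly_add)

lemma eval_rat_poly_altdef:
  "eval_rat_poly p x = (\<Sum>i\<le>degree p. of_rat (coeff p i) * x ^ i)"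
  by (simp add: poly_altdef degree_map_poly coeff_map_poly)

lemma rat_adjoinI: "eval_rat_poly p x \<in> rat_adjoin x"
  by (auto simp: rat_adjoin_def)

lemma of_rat_mem_rat_adjoin: "of_rat c \<in> rat_adjoin x"
  using rat_adjoinI[of "[:c:]" x] by (simp only: eval_rat_poly_const)

lemma Rats_subset_rat_adjoin: "\<rat> \<subseteq> rat_adjoin x"
  by (auto simp: of_rat_mem_rat_adjoin elim!: Rats_cases)

lemma generator_mem_rat_adjoin: "x \<in> rat_adjoin x"
  using rat_adjoinI[of "monom 1 1" x] by (simp add: eval_rat_poly_monom)

lemma subring_rat_adjoin: "subring_of (rat_adjoin x)"
proof
  show "0 \<in> rat_adjoin x" "1 \<in> rat_adjoin x"
    using of_rat_mem_rat_adjoin[of 0] of_rat_mem_rat_adjoin[of 1] by simp_all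
  fix a b assume "a \<in> rat_adjoin x" "b \<in> rat_adjoin x"
  then obtain p q where "a = eval_rat_poly p x" "b = eval_rat_poly q x"
    by (auto simp: rat_adjoin_def)
  then show "a + b \<in> rat_adjoin x" "- a \<in> rat_adjoin x" "a * b \<in> rat_adjoin x"
    by (simp_all flip: eval_rat_poly_add eval_rat_poly_mult eval_rat_poly_minus
        add: rat_adjoinI)
qed

lemma rat_adjoin_subset:
  assumes "y \<in> rat_adjoin x"
  shows "rat_adjoin y \<subseteq> rat_adjoin x"
proof
  interpret subring_of "rat_adjoin x" by (rule subring_rat_adjoin)
  fix z assume "z \<in> rat_adjoin y"
  then obtain p where "z = eval_rat_poly p y" by (auto simp: rat_adjoin_def)
  then show "z \<in> rat_adjoin x"
    using assms
    by (auto simp: eval_rat_poly_altdef intro!: sum_mem mult_mem power_mem of_rat_mem_rat_adjoin)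
qed

lemma real_subfield_Rats: "real_subfield \<rat>"
  by standard auto

text \<open>
  A rational polynomial prime to \<open>f\<close> does not vanish at a root of \<open>f\<close>, and Bezout gives the
  inverse of its value as a value.
\<close>

lemma irreducible_not_dvd_imp_inverse:
  assumes "irreducible f" "eval_rat_poly f x = 0" "\<not> f dvd p"
  obtains q where "eval_rat_poly q x * eval_rat_poly p x = 1"
proof -
  have "prime_elem f"
    using assms(1) by (rule field_poly_irreducible_imp_prime)
  then have "coprime f p"
    using assms(3) by (rule prime_elem_imp_coprime)
  obtain a b where "bezout_coefficients f p = (a, b)" by fastforce
  from bezout_coefficients[OF this] have "a * f + b * p = 1"
    using \<open>coprime f p\<close> by simp
  then have "eval_rat_poly (a * f + b * p) x = eval_rat_poly 1 x" by simp
  then have "eval_rat_poly b x * eval_rat_poly p x = 1"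
    using assms(2) by (simp add: eval_rat_poly_add eval_rat_poly_mult)
  with that show thesis .
qed

lemma irreducible_dvd_of_common_root:
  assumes "irreducible f" "eval_rat_poly f x = 0" "eval_rat_poly p x = 0"
  shows "f dvd p"
  using irreducible_not_dvd_imp_inverse[OF assms(1,2), of p] assms(3) by fastforce

lemma real_subfield_rat_adjoin:
  assumes "irreducible f" "eval_rat_poly f x = 0"
  shows "real_subfield (rat_adjoin x)"
proof -
  interpret subring_of "rat_adjoin x" by (rule subring_rat_adjoin)
  show ?thesis
  proof
    fix a assume "a \<in> rat_adjoin x"
    then obtain p where p: "a = eval_rat_poly p x" by (auto simp: rat_adjoin_def)
    show "inverse a \<in> rat_adjoin x"
    proof (cases "f dvd p")
      case True
      then have "a = 0" using p assms(2) by (auto simp: eval_rat_poly_mult)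
      then show ?thesis by (simp add: zero_mem)
    next
      case False
      then obtain q where "eval_rat_poly q x * a = 1"
        using irreducible_not_dvd_imp_inverse[OF assms] p by blast
      then have "inverse a = eval_rat_poly q x"
        by (metis inverse_unique mult.commute)
      then show ?thesis by (simp add: rat_adjoinI)
    qed
  qed
qed

text \<open>
  The powers \<open>r ^ i\<close> with \<open>i < k\<close> are linearly independent over \<open>K\<close>, and they span \<open>\<rat>[r]\<close> over the
  ring \<open>\<rat>[r ^ k]\<close>, which is contained in \<open>K\<close>.  So the expansion of \<open>x\<close> in these powers with
  coefficients in \<open>\<rat>[r ^ k]\<close> must be the trivial one \<open>x = x * r ^ 0\<close>.
\<close>

lemma (in real_subfield) mem_rat_adjoin_power:
  assumes g: "minimal_poly r g"
    and sub: "rat_adjoin (r ^ degree g) \<subseteq> K"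
    and x: "x \<in> K" "x \<in> rat_adjoin r"
  shows "x \<in> rat_adjoin (r ^ degree g)"
proof -
  define k where "k = degree g"
  let ?S = "rat_adjoin (r ^ k)"
  interpret S: subring_of ?S by (rule subring_rat_adjoin)
  have k: "k > 0" unfolding k_def using g by (rule minimal_poly_degree_pos)
  obtain A where A: "x = eval_rat_poly A r"
    using x by (auto simp: rat_adjoin_def)
  let ?d = "monom 1 k - [:r ^ k:]"
  have d_coeff: "coeff ?d k = 1" "\<And>i. i > k \<Longrightarrow> coeff ?d i = 0"
    using k by (auto simp: coeff_pCons split: nat.splits)
  have deg: "degree ?d = k"
  proof (rule antisym)
    show "degree ?d \<le> k" by (rule degree_le) (use d_coeff in auto)
    show "k \<le> degree ?d" by (rule le_degree) (use d_coeff in auto)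
  qed
  have "coeffs_in ?S ?d"
    by (intro S.coeffs_in_diff S.coeffs_in_monom S.coeffs_in_const S.one_mem
        generator_mem_rat_adjoin)
  moreover have "lead_coeff ?d = 1" using deg d_coeff by simp
  moreover have "coeffs_in ?S (map_poly of_rat A)"
    by (auto simp: coeffs_in_def coeff_map_poly of_rat_mem_rat_adjoin)
  ultimately obtain q h where qh: "map_poly of_rat A = ?d * q + h" "coeffs_in ?S h"
    "\<And>i. i \<ge> degree ?d \<Longrightarrow> coeff h i = 0"
    using S.monic_division by blast
  have "x = poly h r"
    unfolding A qh(1) by (simp add: poly_monom)
  moreover have "coeffs_in K (h - [:x:])"
    using qh(2) sub x(1) by (intro coeffs_in_diff coeffs_in_const) (auto simp: coeffs_in_def k_def)
  moreover have "\<forall>i\<ge>degree g. coeff (h - [:x:]) i = 0"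
    using qh(3)[unfolded deg] k unfolding k_def by (auto simp: coeff_pCons split: nat.splits)
  ultimately have "h - [:x:] = 0"
    using g by (auto simp: minimal_poly_def)
  then have "x = coeff h 0" by simp
  then show ?thesis
    using qh(2) by (simp add: coeffs_in_def k_def)
qed

section \<open>Comparing degrees over the rationals\<close>

text \<open>The reals as a vector space over the rationals, to have linear dependence at hand.\<close>

interpretation rat_real: vector_space "\<lambda>(c::rat) (x::real). of_rat c * x"
  by standard (auto simp: of_rat_add of_rat_mult algebra_simps)

lemma rat_adjoin_subset_span:
  assumes "h \<noteq> 0" "eval_rat_poly h y = 0"
  shows "rat_adjoin y \<subseteq> rat_real.span ((\<lambda>i. y ^ i) ` {..<degree h})"
proof
  fix z assume "z \<in> rat_adjoin y"
  then obtain A where A: "z = eval_rat_poly A y" by (auto simp: rat_adjoin_def)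
  \<comment> \<open>Reducing modulo \<open>h\<close> does not change the value at \<open>y\<close>.\<close>
  let ?b = "A mod h"
  have "eval_rat_poly A y = eval_rat_poly (h * (A div h) + ?b) y" by simp
  also have "\<dots> = eval_rat_poly ?b y"
    using assms(2) by (simp only: eval_rat_poly_add eval_rat_poly_mult mult_zero_left add_0_left)
  finally have z: "z = (\<Sum>i\<le>degree ?b. of_rat (coeff ?b i) * y ^ i)"
    using A by (simp add: eval_rat_poly_altdef)
  show "z \<in> rat_real.span ((\<lambda>i. y ^ i) ` {..<degree h})"
  proof (cases "?b = 0")
    case True
    then show ?thesis unfolding z by (simp add: rat_real.span_zero)
  next
    case False
    then have "degree ?b < degree h"
      using degree_mod_less[OF assms(1), of A] by simp
    then have "y ^ i \<in> rat_real.span ((\<lambda>i. y ^ i) ` {..<degree h})" if "i \<le> degree ?b" for i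
      using that by (intro rat_real.span_base) auto
    then show ?thesis
      unfolding z by (intro rat_real.span_sum rat_real.span_scale) simp
  qed
qed

text \<open>
  The ring \<open>\<rat>[y]\<close> has dimension at most the degree of \<open>h\<close>, so one more power of \<open>z\<close> than that
  forces a linear relation.  Coinciding powers have to be treated apart, because the
  relation speaks about the set of powers.
\<close>

lemma annihilating_poly_degree_le:
  assumes h: "h \<noteq> 0" "eval_rat_poly h y = 0" and z: "z \<in> rat_adjoin y"
  obtains u where "u \<noteq> 0" "degree u \<le> degree h" "eval_rat_poly u z = 0"
proof (cases "inj_on (\<lambda>i. z ^ i) {..degree h}")
  case False
  then obtain i j where ij: "i \<le> degree h" "j \<le> degree h" "i \<noteq> j" "z ^ i = z ^ j"
    by (auto simp: inj_on_def)
  let ?u = "monom 1 i + - monom 1 j :: rat poly"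
  have "coeff ?u i \<noteq> 0" using ij by simp
  then have "?u \<noteq> 0" by (metis coeff_0)
  moreover have "degree ?u \<le> degree h"
    using ij by (intro degree_add_le) (auto simp: degree_monom_eq)
  moreover have "eval_rat_poly ?u z = 0"
    unfolding eval_rat_poly_add eval_rat_poly_minus eval_rat_poly_monom using ij by simp
  ultimately show thesis by (rule that)
next
  case inj: True
  let ?S = "(\<lambda>i. z ^ i) ` {..degree h}" and ?T = "(\<lambda>i. y ^ i) ` {..<degree h}"
  interpret subring_of "rat_adjoin y" by (rule subring_rat_adjoin)
  have "?S \<subseteq> rat_real.span ?T"
    using z power_mem rat_adjoin_subset_span[OF h] by blast
  moreover have "card ?T \<le> degree h"
    using card_image_le[of "{..<degree h}"] by simp
  moreover have "card ?S = Suc (degree h)"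
    using card_image[OF inj] by simp
  ultimately have "rat_real.dependent ?S"
    using rat_real.independent_span_bound[of ?T ?S] by force
  then obtain c where c: "\<exists>v\<in>?S. c v \<noteq> 0" "(\<Sum>v\<in>?S. of_rat (c v) * v) = 0"
    by (subst (asm) rat_real.dependent_finite) auto
  let ?u = "\<Sum>i\<le>degree h. monom (c (z ^ i)) i"
  from c(1) obtain i where i: "i \<le> degree h" "c (z ^ i) \<noteq> 0" by auto
  then have "coeff ?u i \<noteq> 0"
    by (simp add: coeff_sum)
  then have "?u \<noteq> 0" by (metis coeff_0)
  moreover have "degree ?u \<le> degree h"
    by (intro degree_sum_le) (auto intro: order_trans[OF degree_monom_le])
  moreover have "eval_rat_poly ?u z = 0"
    using c(2) by (simp add: eval_rat_poly_sum eval_rat_poly_monom sum.reindex[OF inj])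
  ultimately show thesis by (rule that)
qed

theorem theorem1:
  fixes f :: "rat poly" and n :: nat
  assumes "degree f = n"
    and "irreducible f"
    and "one_solvable f"
  shows "\<exists>(A :: rat poly) (r :: real). r ^ n \<in> \<rat> \<and> eval_rat_poly f (eval_rat_poly A r) = 0"
proof -
  from assms(3) obtain r m x where m: "m > 0" "r ^ m \<in> \<rat>"
    and x: "x \<in> rat_adjoin r" "eval_rat_poly f x = 0"
    by (auto simp: one_solvable_def)
  interpret K: real_subfield "rat_adjoin x"
    using assms(2) x(2) by (rule real_subfield_rat_adjoin)
  interpret Q: real_subfield \<rat>
    by (rule real_subfield_Rats)
  have "r ^ m \<in> rat_adjoin x"
    using m(2) Rats_subset_rat_adjoin by blast
  then obtain g where g: "K.minimal_poly r g" "r ^ degree g \<in> rat_adjoin x"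
    using K.minimal_poly_of_radical m(1) by blast
  define s where "s = r ^ degree g"
  have s_in: "s \<in> rat_adjoin x"
    using g(2) by (simp add: s_def)
  have x_in: "x \<in> rat_adjoin s"
    unfolding s_def using g(1)
  proof (rule K.mem_rat_adjoin_power)
    show "rat_adjoin (r ^ degree g) \<subseteq> rat_adjoin x"
      using g(2) by (rule rat_adjoin_subset)
  qed (use x(1) generator_mem_rat_adjoin in auto)
  have "s ^ m = (r ^ m) ^ degree g"
    unfolding s_def by (simp add: power_mult[symmetric] mult.commute)
  then have "s ^ m \<in> \<rat>"
    using m(2) by simp
  then obtain p where p: "Q.minimal_poly s p" "s ^ degree p \<in> \<rat>"
    using Q.minimal_poly_of_radical m(1) by blast
  \<comment> \<open>\<open>p\<close> and \<open>f\<close> have least degree among the rational polynomials vanishing at \<open>s\<close> and at \<open>x\<close>,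
    and \<open>\<rat>[s] = \<rat>[x]\<close>.\<close>
  have "degree p = n"
  proof (rule antisym)
    have "f \<noteq> 0" using assms(2) by auto
    then obtain u where u: "u \<noteq> 0" "degree u \<le> n" "eval_rat_poly u s = 0"
      using annihilating_poly_degree_le x(2) s_in assms(1) by metis
    have "map_poly of_rat u \<noteq> (0 :: real poly)"
      using u(1) by (simp add: map_poly_eq_0_iff)
    moreover have "coeffs_in \<rat> (map_poly of_rat u :: real poly)"
      by (auto simp: coeffs_in_def coeff_map_poly)
    ultimately obtain i where "i \<ge> degree p" "coeff (map_poly of_rat u :: real poly) i \<noteq> 0"
      using p(1) u(3) by (auto simp: Q.minimal_poly_def)
    then have "degree p \<le> degree u"
      using le_degree[of u i] by (auto simp: coeff_map_poly)
    with u(2) show "degree p \<le> n" by simp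
  next
    have "coeffs_in \<rat> p" "lead_coeff p = 1" "poly p s = 0"
      using p(1) by (auto simp: Q.minimal_poly_def)
    moreover from this obtain h where h: "p = map_poly of_rat h"
      using ratpolyE[of p] by (auto simp: coeffs_in_def)
    ultimately have "h \<noteq> 0" "eval_rat_poly h s = 0"
      by auto
    then obtain v where v: "v \<noteq> 0" "degree v \<le> degree h" "eval_rat_poly v x = 0"
      using annihilating_poly_degree_le x_in by blast
    have "f dvd v"
      using irreducible_dvd_of_common_root assms(2) x(2) v(3) .
    then have "n \<le> degree v"
      using v(1) assms(1) dvd_imp_degree_le by blast
    also have "\<dots> \<le> degree p"
      using v(2) by (simp add: h degree_map_poly)
    finally show "n \<le> degree p" .
  qed
  with p(2) have "s ^ n \<in> \<rat>" by simp
  moreover obtain A where "x = eval_rat_poly A s"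
    using x_in by (auto simp: rat_adjoin_def)
  ultimately show ?thesis
    using x(2) by blast
qed

end
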